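(* Let $F,G:\mathbb{R}\setminus\{0,-1/2\}\to\mathbb{R}$ be functions and let $L$ be the operator $Lf(x)=F(x)\,(f(x)-f(-x))+G(x)\,(f(-x-1)-f(x))$ acting on real polynomials $f$. (a) If $L$ maps $x$ to a polynomial of degree at most $1$ and $x^2$ to a polynomial of degree at most $2$ (in particular, if $L$ maps every polynomial of degree $n$ to a polynomial of degree at most $n$), then there exist real numbers $\xi_0,\xi_1,\eta_0,\eta_1,\eta_2$ such that, with $q_1(x)=\xi_1x+\xi_0$ and $q_2(x)=\eta_2x^2+\eta_1x+\eta_0$, $$F(x)=\frac{q_1(x)+q_2(x)}{2x},\qquad G(x)=\frac{q_2(x)}{2x+1}.$$ (b) Conversely, if $F,G$ have this form, then $L$ maps polynomials to polynomials and for every $n\ge 0$ $$Lx^n=\lambda_nx^n+(\text{polynomial of degree}\le n-1),\qquad \lambda_n=\begin{cases}\dfrac{\eta_2n}{2}, & n\text{ even},\\[4pt] \xi_1-\dfrac{\eta_2(n-1)}{2}, & n \text{ odd}.\end{cases}$$ (c) If $F,G$ have this form, then $L$ maps every polynomial of degree $n\geq 1$ to a polynomial of degree exactly $n$ (for all $n\ge1$) if and only if $\eta_2\neq0$ and $\xi_1\ne \eta_2N$ for all $N=0,1,2,\dots$. Under these conditions, for every $n=0,1,2,\dots$ there is a unique monic polynomial $P_n$ of degree $n$ with $LP_n=\lambda_nP_n$.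
   Context: All identities between functions of $x$ are understood at points $x\in\mathbb{R}\setminus\{0,-1/2\}$; "$Lf$ is a polynomial" means that $Lf$ agrees with a polynomial at those points. In operator notation $L=F(x)(I-R)+G(x)(T^+R-I)$ with $Rf(x)=f(-x)$ and $T^+Rf(x)=f(-x-1)$. *)

theory Defs
  imports Complex_Main "HOL-Computational_Algebra.Polynomial"
begin

text \<open>
  A function on the reals without 0 and \<open>-1/2\<close> is represented by a total function;
  its values at these two points are never used.
\<close>

definition L_dom :: "real set" where
  "L_dom = UNIV - {0, - 1 / 2}"

definition L_op :: "(real \<Rightarrow> real) \<Rightarrow> (real \<Rightarrow> real) \<Rightarrow> (real \<Rightarrow> real) \<Rightarrow> real \<Rightarrow> real" where
  "L_op F G f x = F x * (f x - f (- x)) + G x * (f (- x - 1) - f x)"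

text \<open>
  \<open>L p = q\<close> for polynomials \<open>p\<close>, \<open>q\<close>, as an identity on the common domain. As that domain is
  infinite, at most one polynomial \<open>q\<close> satisfies it for given \<open>p\<close>.
\<close>

definition L_maps :: "(real \<Rightarrow> real) \<Rightarrow> (real \<Rightarrow> real) \<Rightarrow> real poly \<Rightarrow> real poly \<Rightarrow> bool" where
  "L_maps F G p q \<longleftrightarrow> (\<forall>x\<in>L_dom. L_op F G (poly p) x = poly q x)"

definition has_form ::
  "(real \<Rightarrow> real) \<Rightarrow> (real \<Rightarrow> real) \<Rightarrow> real \<Rightarrow> real \<Rightarrow> real \<Rightarrow> real \<Rightarrow> real \<Rightarrow> bool" where
  "has_form F G \<xi>0 \<xi>1 \<eta>0 \<eta>1 \<eta>2 \<longleftrightarrow>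
     (let q1 = (\<lambda>x. \<xi>1 * x + \<xi>0); q2 = (\<lambda>x. \<eta>2 * x ^ 2 + \<eta>1 * x + \<eta>0) in
      \<forall>x\<in>L_dom. F x = (q1 x + q2 x) / (2 * x) \<and> G x = q2 x / (2 * x + 1))"

definition eigval :: "real \<Rightarrow> real \<Rightarrow> nat \<Rightarrow> real" where
  "eigval \<xi>1 \<eta>2 n =
     (if even n then \<eta>2 * real n / 2 else \<xi>1 - \<eta>2 * (real n - 1) / 2)"

end

theory Submission
  imports Defs
begin

text \<open>
  The images of \<open>x\<close> and \<open>x\<^sup>2\<close> are \<open>L x = 2 x F - (2 x + 1) G\<close> and
  \<open>L x\<^sup>2 = (2 x + 1) G\<close>, so prescribing them as polynomials of degree at most 1 and 2 can be
  solved for \<open>F\<close> and \<open>G\<close>, with \<open>q\<^sub>1 = L x\<close> and \<open>q\<^sub>2 = L x\<^sup>2\<close>. This is part (a)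
  (\<open>has_form_if_L_maps_low_degree\<close>).

  For part (b) write \<open>(x + 1)\<^sup>n - (-x)\<^sup>n = (2 x + 1) S\<^sub>n\<close>. The denominators then cancel and
  \<open>L x\<^sup>n = (q\<^sub>1 + q\<^sub>2) x\<^bsup>n-1\<^esup> [n odd] + (-1)\<^sup>n q\<^sub>2 S\<^sub>n\<close>. The two top coefficients of
  \<open>S\<^sub>n\<close>, read off from its defining identity, show that the terms of degree \<open>n + 1\<close> cancel and that
  the coefficient at \<open>x\<^sup>n\<close> is \<open>\<lambda>\<^sub>n\<close> (\<open>L_maps_monom_eigval\<close>).

  So \<open>L\<close> is a triangular linear operator on polynomials with diagonal entries \<open>\<lambda>\<^sub>n\<close>
  (\<open>has_form_triangular\<close>). Such an operator preserves all degrees \<open>n \<ge> 1\<close> iff no \<open>\<lambda>\<^sub>n\<close> with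
  \<open>n \<ge> 1\<close> vanishes, and it has a unique monic eigenpolynomial of each degree if the \<open>\<lambda>\<^sub>n\<close> are
  pairwise distinct (\<open>triangular_ex1_monic_eigenpoly\<close>). The condition on \<open>\<eta>\<^sub>2\<close> and \<open>\<xi>\<^sub>1\<close> says
  both: \<open>\<eta>\<^sub>2 \<noteq> 0\<close> handles even indices and separates indices of equal parity, while
  \<open>\<lambda>\<^bsub>2k+1\<^esub> = 0\<close> means \<open>\<xi>\<^sub>1 = \<eta>\<^sub>2 k\<close> and \<open>\<lambda>\<^bsub>2m\<^esub> = \<lambda>\<^bsub>2k+1\<^esub>\<close> means
  \<open>\<xi>\<^sub>1 = \<eta>\<^sub>2 (m + k)\<close>.
\<close>

section \<open>Triangular operators on polynomials\<close>

lemma eq_0_or_degree_less_if_coeffs_zero: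
  fixes p :: "'a::zero poly"
  assumes "\<And>i. n \<le> i \<Longrightarrow> coeff p i = 0"
  shows "p = 0 \<or> degree p < n"
  using assms leading_coeff_neq_0 linorder_not_le by blast

definition triangular :: "('a::comm_ring_1 poly \<Rightarrow> 'a poly) \<Rightarrow> (nat \<Rightarrow> 'a) \<Rightarrow> bool" where
  "triangular T d \<longleftrightarrow>
     (\<forall>p n. degree p \<le> n \<longrightarrow> degree (T p) \<le> n \<and> coeff (T p) n = d n * coeff p n)"

lemma triangular_if_monom:
  fixes T :: "'a::comm_ring_1 poly \<Rightarrow> 'a poly"
  assumes add: "\<And>p q. T (p + q) = T p + T q"
    and smult: "\<And>c p. T (smult c p) = smult c (T p)"
    and monom: "\<And>n i. n \<le> i \<Longrightarrow> coeff (T (monom 1 n)) i = coeff (monom (d n) n) i"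
  shows "triangular T d"
  unfolding triangular_def
proof (intro allI impI)
  fix p :: "'a poly" and n :: nat
  assume "degree p \<le> n"
  have T0: "T 0 = 0"
    using smult[of 0 0] by simp
  have Tsum: "T (\<Sum>i\<in>A. f i) = (\<Sum>i\<in>A. T (f i))" if "finite A" for A and f :: "nat \<Rightarrow> 'a poly"
    using that by (induction A rule: finite_induct) (simp_all add: T0 add)
  have "p = (\<Sum>i\<le>n. monom (coeff p i) i)"
    using poly_as_sum_of_monoms'[OF \<open>degree p \<le> n\<close>] by simp
  also have "\<dots> = (\<Sum>i\<le>n. smult (coeff p i) (monom 1 i))"
    by (simp add: smult_monom)
  finally have "T p = (\<Sum>i\<le>n. smult (coeff p i) (T (monom 1 i)))"
    using Tsum[of "{..n}" "\<lambda>i. smult (coeff p i) (monom 1 i)"] smult by simp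
  then have cf: "coeff (T p) k = (\<Sum>i\<le>n. if i = k then d k * coeff p k else 0)" if "k \<ge> n" for k
  proof -
    have "coeff (smult (coeff p i) (T (monom 1 i))) k = (if i = k then d k * coeff p k else 0)"
      if "i \<le> n" for i
      using that \<open>k \<ge> n\<close> by (simp add: monom)
    then show ?thesis
      unfolding \<open>T p = _\<close> coeff_sum by (intro sum.cong) auto
  qed
  have "coeff (T p) k = 0" if "k > n" for k
    using that by (simp add: cf)
  then have "degree (T p) \<le> n"
    by (intro degree_le) auto
  moreover have "coeff (T p) n = d n * coeff p n"
    by (simp add: cf)
  ultimately show "degree (T p) \<le> n \<and> coeff (T p) n = d n * coeff p n" ..
qed

text \<open>
  Back substitution: the entry \<open>d m - c\<close> is invertible for \<open>m < n\<close>, so the top coefficient of the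
  right-hand side can be removed by a multiple of \<open>x\<^bsup>m\<^esup>\<close>, leaving lower degree.
\<close>

lemma triangular_solve_below:
  fixes T :: "'a::field poly \<Rightarrow> 'a poly"
  assumes tri: "triangular T d"
    and add: "\<And>p q. T (p + q) = T p + T q"
    and smult: "\<And>c p. T (smult c p) = smult c (T p)"
    and neq: "\<And>k. k < n \<Longrightarrow> d k \<noteq> c"
    and "\<And>i. n \<le> i \<Longrightarrow> coeff g i = 0"
  shows "\<exists>h. (\<forall>i\<ge>n. coeff h i = 0) \<and> T h - smult c h = g"
  using neq assms(5)
proof (induction n arbitrary: g)
  case 0
  then have "g = 0"
    by (simp add: poly_eq_iff)
  moreover have "T 0 = 0"
    using smult[of 0 0] by simp
  ultimately show ?case
    by (intro exI[of _ 0]) simp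
next
  case (Suc n)
  define h0 where "h0 = monom (coeff g n / (d n - c)) n"
  define g' where "g' = g - (T h0 - smult c h0)"
  have "degree h0 \<le> n"
    by (simp add: h0_def degree_monom_le)
  then have deg: "degree (T h0) \<le> n" and cf: "coeff (T h0) n = d n * coeff h0 n"
    using tri by (auto simp: triangular_def)
  have "d n \<noteq> c"
    using Suc.prems(1) by simp
  have "coeff g' i = 0" if "n \<le> i" for i
  proof (cases "i = n")
    case True
    have "coeff g' n = coeff g n - (d n - c) * coeff h0 n"
      by (simp add: g'_def cf algebra_simps)
    then show ?thesis
      using True \<open>d n \<noteq> c\<close> by (simp add: h0_def)
  next
    case False
    then have "Suc n \<le> i"
      using that by simp
    then show ?thesis
      using Suc.prems(2) deg by (simp add: g'_def h0_def coeff_eq_0)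
  qed
  then obtain h where h: "\<forall>i\<ge>n. coeff h i = 0" "T h - smult c h = g'"
    using Suc.IH Suc.prems(1) by (metis less_SucI)
  have "T (h + h0) - smult c (h + h0) = g"
    using h(2) by (simp add: add g'_def smult_add_right algebra_simps)
  moreover have "\<forall>i\<ge>Suc n. coeff (h + h0) i = 0"
    using h(1) by (simp add: h0_def)
  ultimately show ?case
    by blast
qed

lemma triangular_ex1_monic_eigenpoly:
  fixes T :: "'a::field poly \<Rightarrow> 'a poly"
  assumes tri: "triangular T d"
    and add: "\<And>p q. T (p + q) = T p + T q"
    and smult: "\<And>c p. T (smult c p) = smult c (T p)"
    and neq: "\<And>k. k < n \<Longrightarrow> d k \<noteq> d n"
  shows "\<exists>!P. lead_coeff P = 1 \<and> degree P = n \<and> T P = smult (d n) P"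
proof (rule ex_ex1I)
  have deg: "degree (T (monom 1 n)) \<le> n" and cf: "coeff (T (monom 1 n)) n = d n"
    using tri by (auto simp: triangular_def degree_monom_le)
  \<comment> \<open>The eigenpolynomial is \<open>x\<^sup>n + h\<close>, where \<open>h\<close> corrects the defect of \<open>x\<^sup>n\<close>.\<close>
  define g where "g = smult (d n) (monom 1 n) - T (monom 1 n)"
  have "coeff g i = 0" if "n \<le> i" for i
    using that deg cf by (cases "i = n") (simp_all add: g_def coeff_eq_0)
  then obtain h where h: "\<forall>i\<ge>n. coeff h i = 0" "T h - smult (d n) h = g"
    using triangular_solve_below[OF tri add smult neq] by metis
  define P where "P = monom 1 n + h"
  have "coeff P n = 1"
    using h(1) by (simp add: P_def)
  moreover have "degree P \<le> n"
    using h(1) by (intro degree_le) (simp add: P_def)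
  ultimately have "degree P = n"
    by (metis le_antisym le_degree zero_neq_one)
  moreover have "T P = smult (d n) P"
    using h(2) by (simp add: P_def g_def add smult_add_right algebra_simps)
  ultimately show "\<exists>P. lead_coeff P = 1 \<and> degree P = n \<and> T P = smult (d n) P"
    using \<open>coeff P n = 1\<close> by blast
next
  fix P Q
  assume P: "lead_coeff P = 1 \<and> degree P = n \<and> T P = smult (d n) P"
    and Q: "lead_coeff Q = 1 \<and> degree Q = n \<and> T Q = smult (d n) Q"
  define D where "D = P - Q"
  have "T D = T (P + smult (- 1) Q)"
    by (simp add: D_def)
  also have "\<dots> = smult (d n) P + smult (- 1) (smult (d n) Q)"
    using P Q by (simp only: add smult)
  also have "\<dots> = smult (d n) D"
    by (simp add: D_def smult_diff_right)
  finally have TD: "T D = smult (d n) D" .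
  have "coeff D i = 0" if "n \<le> i" for i
    using that P Q by (cases "i = n") (auto simp: D_def coeff_eq_0)
  then have "D = 0 \<or> degree D < n"
    by (rule eq_0_or_degree_less_if_coeffs_zero)
  moreover have "d (degree D) * lead_coeff D = d n * lead_coeff D"
    using tri TD unfolding triangular_def by (metis coeff_smult order_refl)
  ultimately have "D = 0"
    using neq by auto
  then show "P = Q"
    by (simp add: D_def)
qed

lemma triangular_degree_eq_iff:
  fixes T :: "'a::idom poly \<Rightarrow> 'a poly"
  assumes "triangular T d"
  shows "(\<forall>n\<ge>1. \<forall>p. degree p = n \<longrightarrow> degree (T p) = n) \<longleftrightarrow> (\<forall>n\<ge>1. d n \<noteq> 0)"
proof (intro iffI allI impI)
  fix n :: nat
  assume *: "\<forall>n\<ge>1. \<forall>p. degree p = n \<longrightarrow> degree (T p) = n" and "n \<ge> 1"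
  have "degree (T (monom 1 n)) = n"
    using * \<open>n \<ge> 1\<close> by (simp add: degree_monom_eq)
  then have "coeff (T (monom 1 n)) n \<noteq> 0"
    using \<open>n \<ge> 1\<close> by (metis degree_0 leading_coeff_0_iff not_one_le_zero)
  moreover have "coeff (T (monom 1 n)) n = d n"
    using assms by (simp add: triangular_def degree_monom_le)
  ultimately show "d n \<noteq> 0"
    by simp
next
  fix n :: nat and p :: "'a poly"
  assume d: "\<forall>n\<ge>1. d n \<noteq> 0" and "n \<ge> 1" "degree p = n"
  then have "coeff p n \<noteq> 0"
    by (metis degree_0 leading_coeff_0_iff not_one_le_zero)
  then have "coeff (T p) n \<noteq> 0" and "degree (T p) \<le> n"
    using assms d \<open>n \<ge> 1\<close> \<open>degree p = n\<close> by (auto simp: triangular_def)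
  then show "degree (T p) = n"
    by (simp add: le_antisym le_degree)
qed

section \<open>The operator as a relation between polynomials\<close>

lemma L_maps_add: "L_maps F G p q \<Longrightarrow> L_maps F G p' q' \<Longrightarrow> L_maps F G (p + p') (q + q')"
proof -
  have "L_op F G (poly (p + p')) x = L_op F G (poly p) x + L_op F G (poly p') x" for x
    by (simp add: L_op_def algebra_simps)
  then show "L_maps F G p q \<Longrightarrow> L_maps F G p' q' \<Longrightarrow> L_maps F G (p + p') (q + q')"
    by (simp add: L_maps_def)
qed

lemma L_maps_smult: "L_maps F G p q \<Longrightarrow> L_maps F G (smult c p) (smult c q)"
proof -
  have "L_op F G (poly (smult c p)) x = c * L_op F G (poly p) x" for x
    by (simp add: L_op_def algebra_simps)
  then show "L_maps F G p q \<Longrightarrow> L_maps F G (smult c p) (smult c q)"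
    by (simp add: L_maps_def)
qed

lemma infinite_L_dom: "infinite L_dom"
  unfolding L_dom_def by (simp add: infinite_UNIV_char_0)

lemma L_maps_unique:
  assumes "L_maps F G p q" "L_maps F G p q'"
  shows "q = q'"
proof (rule ccontr)
  assume "q \<noteq> q'"
  then have "finite {x. poly (q - q') x = 0}"
    by (intro poly_roots_finite) simp
  moreover have "L_dom \<subseteq> {x. poly (q - q') x = 0}"
    using assms by (auto simp: L_maps_def)
  ultimately show False
    using infinite_L_dom finite_subset by blast
qed

lemma has_form_if_L_maps_low_degree:
  assumes q: "degree q \<le> 1" "L_maps F G (monom 1 1) q"
    and r: "degree r \<le> 2" "L_maps F G (monom 1 2) r"
  shows "has_form F G (coeff q 0) (coeff q 1) (coeff r 0) (coeff r 1) (coeff r 2)"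
proof -
  have quad: "poly p x = coeff p 2 * x ^ 2 + coeff p 1 * x + coeff p 0"
    if "degree p \<le> 2" for p :: "real poly" and x
  proof -
    have "poly p x = poly (\<Sum>i\<le>2. monom (coeff p i) i) x"
      using that by (simp add: poly_as_sum_of_monoms')
    then show ?thesis
      by (simp add: poly_monom eval_nat_numeral algebra_simps)
  qed
  have pq: "poly q x = coeff q 1 * x + coeff q 0" for x
    using quad[of q x] q(1) by (simp add: coeff_eq_0)
  have pr: "poly r x = coeff r 2 * x ^ 2 + coeff r 1 * x + coeff r 0" for x
    using r(1) by (rule quad)
  have "F x = (poly q x + poly r x) / (2 * x) \<and> G x = poly r x / (2 * x + 1)"
    if x: "x \<in> L_dom" for x
  proof -
    have "x \<noteq> 0" "2 * x + 1 \<noteq> 0"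
      using x by (auto simp: L_dom_def)
    have Lx: "poly q x = F x * (2 * x) - G x * (2 * x + 1)"
      using q(2) x by (simp add: L_maps_def L_op_def poly_monom algebra_simps)
    have Lx2: "poly r x = G x * (2 * x + 1)"
      using r(2) x by (simp add: L_maps_def L_op_def poly_monom power2_eq_square algebra_simps)
    have "F x = (poly q x + poly r x) / (2 * x)"
      unfolding Lx Lx2 using \<open>x \<noteq> 0\<close> by simp
    moreover have "G x = poly r x / (2 * x + 1)"
      unfolding Lx2 using \<open>2 * x + 1 \<noteq> 0\<close> by simp
    ultimately show ?thesis ..
  qed
  then show ?thesis
    by (simp add: has_form_def Let_def pq pr)
qed

section \<open>Images of the monomials\<close>

text \<open>
  The factor \<open>S\<^sub>n\<close> of \<open>(x + 1)\<^sup>n - (-x)\<^sup>n\<close> complementary to \<open>2 x + 1 = (x + 1) - (-x)\<close>,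
  given by the geometric sum.
\<close>

definition shift_quot :: "nat \<Rightarrow> real poly" where
  "shift_quot n = (\<Sum>i<n. [:1, 1:] ^ i * [:0, - 1:] ^ (n - Suc i))"

lemma shift_quot_mult: "[:1, 2:] * shift_quot n = [:1, 1:] ^ n - [:0, - 1:] ^ n"
proof -
  have "[:1, 1:] - [:0, - 1:] = ([:1, 2:] :: real poly)"
    by simp
  then show ?thesis
    unfolding shift_quot_def
    using power_diff_sumr2[of "[:1, 1:] :: real poly" n "[:0, - 1:]"]
    by (simp add: mult.commute)
qed

text \<open>
  Comparing the coefficients at \<open>x\<^bsup>m+1\<^esup>\<close> and \<open>x\<^bsup>m\<^esup>\<close> in \<open>(2 x + 1) S\<^sub>n = (x + 1)\<^sup>n - (-x)\<^sup>n\<close>,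
  where \<open>n = m + 1\<close>, determines the two top coefficients of \<open>S\<^sub>n\<close> without evaluating alternating
  sums. Prepending a zero coefficient covers \<open>m = 0\<close> in the second one.
\<close>

lemma
  shows coeff_shift_quot_eq_0: "m < i \<Longrightarrow> coeff (shift_quot (Suc m)) i = 0"
    and coeff_shift_quot_top: "coeff (shift_quot (Suc m)) m = (if even m then 1 else 0)"
    and coeff_shift_quot_next:
      "coeff (pCons 0 (shift_quot (Suc m))) m = (if even m then real m / 2 else real (Suc m) / 2)"
proof -
  let ?S = "shift_quot (Suc m)"
  have mon: "[:0, - 1:] ^ k = (monom ((- 1) ^ k) k :: real poly)" for k
    using monom_power[of "- 1 :: real" 1 k] by (simp add: monom_Suc monom_0)
  have "degree ([:1, 2:] * ?S) \<le> Suc m"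
    unfolding shift_quot_mult
    by (intro degree_diff_le) (simp_all only: mon degree_linear_power degree_monom_le)
  then have deg: "degree ?S \<le> m"
    by (cases "?S = 0") (simp_all add: degree_mult_eq del: mult_pCons_left)
  then show zero: "m < i \<Longrightarrow> coeff ?S i = 0" for i
    by (simp add: coeff_eq_0)
  have prod: "coeff ([:1, 2:] * ?S) k = coeff ?S k + 2 * coeff (pCons 0 ?S) k" for k
    by (simp add: coeff_pCons split: nat.split)
  have rhs: "coeff ([:1, 2:] * ?S) k
      = real (Suc m choose k) - (if k = Suc m then (- 1) ^ Suc m else 0)" if "k \<le> Suc m" for k
    unfolding shift_quot_mult using that
    by (simp add: mon coeff_linear_poly_power del: power_Suc)
  show top: "coeff ?S m = (if even m then 1 else 0)"
    using prod[of "Suc m"] rhs[of "Suc m"] zero[of "Suc m"] by (cases "even m") simp_all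
  show "coeff (pCons 0 ?S) m = (if even m then real m / 2 else real (Suc m) / 2)"
    using prod[of m] rhs[of m] top by (cases "even m") simp_all
qed

definition monom_image :: "real \<Rightarrow> real \<Rightarrow> real \<Rightarrow> real \<Rightarrow> real \<Rightarrow> nat \<Rightarrow> real poly" where
  "monom_image \<xi>0 \<xi>1 \<eta>0 \<eta>1 \<eta>2 n =
     (if odd n then [:\<xi>0 + \<eta>0, \<xi>1 + \<eta>1, \<eta>2:] * monom 1 (n - 1) else 0)
       + smult ((- 1) ^ n) ([:\<eta>0, \<eta>1, \<eta>2:] * shift_quot n)"

lemma L_maps_monom_image:
  assumes "has_form F G \<xi>0 \<xi>1 \<eta>0 \<eta>1 \<eta>2"
  shows "L_maps F G (monom 1 n) (monom_image \<xi>0 \<xi>1 \<eta>0 \<eta>1 \<eta>2 n)"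
  unfolding L_maps_def
proof
  fix x assume x: "x \<in> L_dom"
  then have "x \<noteq> 0" "2 * x + 1 \<noteq> 0"
    by (auto simp: L_dom_def)
  define q1 where "q1 = \<xi>1 * x + \<xi>0"
  define q2 where "q2 = \<eta>2 * x ^ 2 + \<eta>1 * x + \<eta>0"
  have F: "F x = (q1 + q2) / (2 * x)" and G: "G x = q2 / (2 * x + 1)"
    using assms x by (simp_all add: has_form_def Let_def q1_def q2_def)
  have "poly ([:1, 2:] * shift_quot n) x = (x + 1) ^ n - (- x) ^ n"
    unfolding shift_quot_mult by (simp add: poly_power add.commute)
  then have S: "(x + 1) ^ n - (- x) ^ n = (2 * x + 1) * poly (shift_quot n) x"
    by (simp add: algebra_simps)
  have "(- x - 1) ^ n - x ^ n = (- 1) ^ n * ((x + 1) ^ n - (- x) ^ n)"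
    by (simp add: right_diff_distrib flip: power_mult_distrib)
  then have Gpart: "G x * ((- x - 1) ^ n - x ^ n) = (- 1) ^ n * (q2 * poly (shift_quot n) x)"
    unfolding S G using \<open>2 * x + 1 \<noteq> 0\<close> by simp
  have Fpart: "F x * (x ^ n - (- x) ^ n) = (if odd n then (q1 + q2) * x ^ (n - 1) else 0)"
    unfolding F using \<open>x \<noteq> 0\<close> by (cases n) simp_all
  have pq2: "poly [:\<eta>0, \<eta>1, \<eta>2:] x = q2"
    by (simp add: q2_def power2_eq_square algebra_simps)
  have pq1: "poly [:\<xi>0 + \<eta>0, \<xi>1 + \<eta>1, \<eta>2:] x = q1 + q2"
    by (simp add: q1_def q2_def power2_eq_square algebra_simps)
  show "L_op F G (poly (monom 1 n)) x = poly (monom_image \<xi>0 \<xi>1 \<eta>0 \<eta>1 \<eta>2 n) x"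
    unfolding L_op_def monom_image_def poly_add poly_smult poly_mult pq2
    by (simp add: poly_monom Fpart Gpart pq1 del: poly_pCons mult_pCons_left)
qed

text \<open>
  For odd \<open>n\<close> the term \<open>\<eta>\<^sub>2 x\<^bsup>n+1\<^esup>\<close> from \<open>q\<^sub>2 x\<^bsup>n-1\<^esup>\<close> cancels against the one from
  \<open>- q\<^sub>2 S\<^sub>n\<close>, since \<open>S\<^sub>n\<close> is then monic of degree \<open>n - 1\<close>; for even \<open>n \<ge> 2\<close> the degree of
  \<open>S\<^sub>n\<close> is only \<open>n - 2\<close>, so no term of degree \<open>n + 1\<close> arises.
\<close>

lemma coeff_monom_image:
  assumes "n \<le> i"
  shows "coeff (monom_image \<xi>0 \<xi>1 \<eta>0 \<eta>1 \<eta>2 n) i = coeff (monom (eigval \<xi>1 \<eta>2 n) n) i"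
proof (cases n)
  case 0
  then show ?thesis
    by (simp add: monom_image_def shift_quot_def eigval_def)
next
  case (Suc m)
  let ?S = "shift_quot (Suc m)"
  have quad: "coeff ([:a, b, c:] * p) (Suc j)
      = a * coeff p (Suc j) + b * coeff p j + c * coeff (pCons 0 p) j" for a b c :: real and p j
    by (simp add: coeff_pCons split: nat.split)
  obtain j where i: "i = Suc j" and "m \<le> j"
    using assms Suc by (metis Suc_le_D Suc_le_mono)
  consider "j = m" | "j = Suc m" | "j > Suc m"
    using \<open>m \<le> j\<close> by linarith
  then show ?thesis
  proof cases
    case 1
    have "coeff (pCons 0 (monom 1 m)) m = (0 :: real)"
      by (simp flip: monom_Suc)
    then show ?thesis
      using 1
      unfolding monom_image_def Suc i
      by (simp add: quad coeff_shift_quot_eq_0 coeff_shift_quot_top coeff_shift_quot_next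
          eigval_def del: mult_pCons_left)
        (simp add: field_simps)?
  next
    case 2
    then show ?thesis
      unfolding monom_image_def Suc i
      by (simp add: quad coeff_shift_quot_eq_0 coeff_shift_quot_top del: mult_pCons_left)
  next
    case 3
    then obtain l where "j = Suc l" "m < l"
      by (metis Suc_lessE Suc_less_eq)
    then show ?thesis
      unfolding monom_image_def Suc i
      by (simp add: quad coeff_shift_quot_eq_0 del: mult_pCons_left)
  qed
qed

lemma L_maps_monom_eigval:
  assumes "has_form F G \<xi>0 \<xi>1 \<eta>0 \<eta>1 \<eta>2"
  shows "\<exists>r. (r = 0 \<or> degree r < n) \<and>
           L_maps F G (monom 1 n) (monom (eigval \<xi>1 \<eta>2 n) n + r)"
proof -
  let ?r = "monom_image \<xi>0 \<xi>1 \<eta>0 \<eta>1 \<eta>2 n - monom (eigval \<xi>1 \<eta>2 n) n"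
  have "?r = 0 \<or> degree ?r < n"
    by (rule eq_0_or_degree_less_if_coeffs_zero) (simp only: coeff_diff coeff_monom_image diff_self)
  then show ?thesis
    using L_maps_monom_image[OF assms, of n] by (intro exI[of _ ?r]) simp
qed

section \<open>The operator is triangular\<close>

lemma L_maps_ex:
  assumes "has_form F G \<xi>0 \<xi>1 \<eta>0 \<eta>1 \<eta>2"
  shows "\<exists>q. L_maps F G p q"
proof -
  have zero: "L_maps F G 0 0"
    by (simp add: L_maps_def L_op_def)
  have "\<exists>q. L_maps F G (\<Sum>i\<in>A. monom (coeff p i) i) q" if "finite A" for A
    using that
  proof (induction A rule: finite_induct)
    case empty
    then show ?case
      using zero by auto
  next
    case (insert i A)
    have "L_maps F G (monom (coeff p i) i) (smult (coeff p i) (monom_image \<xi>0 \<xi>1 \<eta>0 \<eta>1 \<eta>2 i))"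
      using L_maps_smult[OF L_maps_monom_image[OF assms, of i], of "coeff p i"]
      by (simp add: smult_monom)
    moreover obtain q where "L_maps F G (\<Sum>i\<in>A. monom (coeff p i) i) q"
      using insert.IH by blast
    ultimately show ?case
      using insert.hyps by (auto dest: L_maps_add)
  qed
  from this[of "{..degree p}"] show ?thesis
    by (simp add: poly_as_sum_of_monoms)
qed

lemma has_form_triangular:
  assumes form: "has_form F G \<xi>0 \<xi>1 \<eta>0 \<eta>1 \<eta>2"
  obtains T where "\<And>p q. L_maps F G p q \<longleftrightarrow> q = T p"
    and "\<And>p q. T (p + q) = T p + T q"
    and "\<And>c p. T (smult c p) = smult c (T p)"
    and "triangular T (eigval \<xi>1 \<eta>2)"
proof -
  obtain T where T: "\<And>p. L_maps F G p (T p)"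
    using L_maps_ex[OF form] by metis
  have iff: "L_maps F G p q \<longleftrightarrow> q = T p" for p q
    using T L_maps_unique by blast
  have add: "T (p + q) = T p + T q" for p q
    using L_maps_add[OF T[of p] T[of q]] iff by simp
  have smult: "T (smult c p) = smult c (T p)" for c p
    using L_maps_smult[OF T[of p], of c] iff by simp
  have "T (monom 1 n) = monom_image \<xi>0 \<xi>1 \<eta>0 \<eta>1 \<eta>2 n" for n
    using L_maps_monom_image[OF form, of n] iff by simp
  then have "triangular T (eigval \<xi>1 \<eta>2)"
    by (intro triangular_if_monom add smult) (simp only: coeff_monom_image)
  then show thesis
    using that iff add smult by blast
qed

section \<open>Eigenvalues\<close>

lemma eigval_even [simp]: "eigval \<xi>1 \<eta>2 (2 * m) = \<eta>2 * real m"
  by (simp add: eigval_def)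

lemma eigval_odd [simp]: "eigval \<xi>1 \<eta>2 (Suc (2 * m)) = \<xi>1 - \<eta>2 * real m"
  by (simp add: eigval_def)

lemma eigval_nonzero_iff:
  "(\<forall>n\<ge>1. eigval \<xi>1 \<eta>2 n \<noteq> 0) \<longleftrightarrow> \<eta>2 \<noteq> 0 \<and> (\<forall>N::nat. \<xi>1 \<noteq> \<eta>2 * real N)"
proof
  assume *: "\<forall>n\<ge>1. eigval \<xi>1 \<eta>2 n \<noteq> 0"
  have "\<eta>2 \<noteq> 0"
    using *[rule_format, of "2 * 1"] unfolding eigval_even by simp
  moreover have "\<xi>1 \<noteq> \<eta>2 * real N" for N :: nat
    using *[rule_format, of "Suc (2 * N)"] by simp
  ultimately show "\<eta>2 \<noteq> 0 \<and> (\<forall>N::nat. \<xi>1 \<noteq> \<eta>2 * real N)"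
    by blast
next
  assume *: "\<eta>2 \<noteq> 0 \<and> (\<forall>N::nat. \<xi>1 \<noteq> \<eta>2 * real N)"
  show "\<forall>n\<ge>1. eigval \<xi>1 \<eta>2 n \<noteq> 0"
  proof (intro allI impI)
    fix n :: nat assume "1 \<le> n"
    consider m where "n = 2 * m" "m \<noteq> 0" | m where "n = Suc (2 * m)"
      using \<open>1 \<le> n\<close> by (metis evenE oddE Suc_eq_plus1 mult_0_right not_one_le_zero)
    then show "eigval \<xi>1 \<eta>2 n \<noteq> 0"
      using * by cases auto
  qed
qed

lemma eigval_inj:
  assumes "\<eta>2 \<noteq> 0" and ne: "\<And>N::nat. \<xi>1 \<noteq> \<eta>2 * real N"
  shows "inj (eigval \<xi>1 \<eta>2)"
proof (rule injI)
  fix i j assume eq: "eigval \<xi>1 \<eta>2 i = eigval \<xi>1 \<eta>2 j"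
  have mixed: "eigval \<xi>1 \<eta>2 (2 * m) \<noteq> eigval \<xi>1 \<eta>2 (Suc (2 * k))" for m k
    using ne[of "m + k"] by (simp add: distrib_left eq_diff_eq)
  have half: "n = 2 * (n div 2) \<or> n = Suc (2 * (n div 2))" for n :: nat
    by presburger
  from half[of i] half[of j] show "i = j"
  proof (elim disjE)
    assume i: "i = 2 * (i div 2)" and j: "j = 2 * (j div 2)"
    have "\<eta>2 * real (i div 2) = \<eta>2 * real (j div 2)"
      using eq i j by (metis eigval_even)
    then show ?thesis
      using i j \<open>\<eta>2 \<noteq> 0\<close> by simp
  next
    assume i: "i = Suc (2 * (i div 2))" and j: "j = Suc (2 * (j div 2))"
    have "\<xi>1 - \<eta>2 * real (i div 2) = \<xi>1 - \<eta>2 * real (j div 2)"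
      using eq i j by (metis eigval_odd)
    then have "i div 2 = j div 2"
      using \<open>\<eta>2 \<noteq> 0\<close> by simp
    then show ?thesis
      using i j by metis
  qed (use eq mixed in metis)+
qed

section \<open>The classification\<close>

theorem mainTheorem1:
  fixes F G :: "real \<Rightarrow> real"
  shows
    "((\<exists>q. degree q \<le> 1 \<and> L_maps F G (monom 1 1) q) \<and>
      (\<exists>q. degree q \<le> 2 \<and> L_maps F G (monom 1 2) q)
        \<longrightarrow> (\<exists>\<xi>0 \<xi>1 \<eta>0 \<eta>1 \<eta>2. has_form F G \<xi>0 \<xi>1 \<eta>0 \<eta>1 \<eta>2))
   \<and> ((\<forall>n p. degree p = n \<longrightarrow> (\<exists>q. degree q \<le> n \<and> L_maps F G p q))
        \<longrightarrow> (\<exists>\<xi>0 \<xi>1 \<eta>0 \<eta>1 \<eta>2. has_form F G \<xi>0 \<xi>1 \<eta>0 \<eta>1 \<eta>2))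
   \<and> (\<forall>\<xi>0 \<xi>1 \<eta>0 \<eta>1 \<eta>2. has_form F G \<xi>0 \<xi>1 \<eta>0 \<eta>1 \<eta>2 \<longrightarrow>
        (\<forall>p. \<exists>q. L_maps F G p q)
      \<and> (\<forall>n. \<exists>r. (r = 0 \<or> degree r < n) \<and>
            L_maps F G (monom 1 n) (monom (eigval \<xi>1 \<eta>2 n) n + r)))
   \<and> (\<forall>\<xi>0 \<xi>1 \<eta>0 \<eta>1 \<eta>2. has_form F G \<xi>0 \<xi>1 \<eta>0 \<eta>1 \<eta>2 \<longrightarrow>
        ((\<forall>n\<ge>1. \<forall>p. degree p = n \<longrightarrow> (\<exists>q. degree q = n \<and> L_maps F G p q))
           \<longleftrightarrow> \<eta>2 \<noteq> 0 \<and> (\<forall>N::nat. \<xi>1 \<noteq> \<eta>2 * real N))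
      \<and> (\<eta>2 \<noteq> 0 \<and> (\<forall>N::nat. \<xi>1 \<noteq> \<eta>2 * real N) \<longrightarrow>
           (\<forall>n. \<exists>!P. lead_coeff P = 1 \<and> degree P = n \<and>
              L_maps F G P (smult (eigval \<xi>1 \<eta>2 n) P))))"
proof (intro conjI allI impI)
  show "\<exists>\<xi>0 \<xi>1 \<eta>0 \<eta>1 \<eta>2. has_form F G \<xi>0 \<xi>1 \<eta>0 \<eta>1 \<eta>2"
    if "(\<exists>q. degree q \<le> 1 \<and> L_maps F G (monom 1 1) q) \<and>
        (\<exists>q. degree q \<le> 2 \<and> L_maps F G (monom 1 2) q)"
    using that has_form_if_L_maps_low_degree by blast
  show "\<exists>\<xi>0 \<xi>1 \<eta>0 \<eta>1 \<eta>2. has_form F G \<xi>0 \<xi>1 \<eta>0 \<eta>1 \<eta>2"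
    if *: "\<forall>n p. degree p = n \<longrightarrow> (\<exists>q. degree q \<le> n \<and> L_maps F G p q)"
  proof -
    have "\<exists>q. degree q \<le> n \<and> L_maps F G (monom 1 n) q" for n
      using *[rule_format, of "monom 1 n" n] by (simp add: degree_monom_eq)
    then show ?thesis
      using has_form_if_L_maps_low_degree by metis
  qed
next
  fix \<xi>0 \<xi>1 \<eta>0 \<eta>1 \<eta>2
  assume form: "has_form F G \<xi>0 \<xi>1 \<eta>0 \<eta>1 \<eta>2"
  show "\<exists>q. L_maps F G p q" for p
    using form by (rule L_maps_ex)
  show "\<exists>r. (r = 0 \<or> degree r < n) \<and>
          L_maps F G (monom 1 n) (monom (eigval \<xi>1 \<eta>2 n) n + r)" for n
    using form by (rule L_maps_monom_eigval)
  obtain T where T: "\<And>p q. L_maps F G p q \<longleftrightarrow> q = T p"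
    and add: "\<And>p q. T (p + q) = T p + T q"
    and smult: "\<And>c p. T (smult c p) = smult c (T p)"
    and tri: "triangular T (eigval \<xi>1 \<eta>2)"
    using has_form_triangular[OF form] by blast
  show "(\<forall>n\<ge>1. \<forall>p. degree p = n \<longrightarrow> (\<exists>q. degree q = n \<and> L_maps F G p q))
      \<longleftrightarrow> \<eta>2 \<noteq> 0 \<and> (\<forall>N::nat. \<xi>1 \<noteq> \<eta>2 * real N)"
    using triangular_degree_eq_iff[OF tri] eigval_nonzero_iff[of \<xi>1 \<eta>2] by (simp add: T)
  show "\<exists>!P. lead_coeff P = 1 \<and> degree P = n \<and> L_maps F G P (smult (eigval \<xi>1 \<eta>2 n) P)"
    if "\<eta>2 \<noteq> 0 \<and> (\<forall>N::nat. \<xi>1 \<noteq> \<eta>2 * real N)" for n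
  proof -
    have "inj (eigval \<xi>1 \<eta>2)"
      using that by (intro eigval_inj) auto
    then have "eigval \<xi>1 \<eta>2 k \<noteq> eigval \<xi>1 \<eta>2 n" if "k < n" for k
      using that by (auto dest: injD)
    from triangular_ex1_monic_eigenpoly[OF tri add smult this]
    show ?thesis
      by (simp add: T eq_commute[of "smult _ _"])
  qed
qed

end
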